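(* Fix $n\geq3$. The closure $\overline{\mathcal{AC}}_n$ of $\mathcal{AC}_n$ in $[0,\infty)^n$ is $$\overline{\mathcal{AC}}_n=\mathcal{AC}_n\cup\mathcal{HC}_n\cup\Big(\bigcup_{3\leq m<n,\ I\in\mathcal{I}_{m,n}}\phi_I(\mathcal{AC}_m\cup\mathcal{HC}_m)\Big)\cup\Big(\bigcup_{I\in\mathcal{I}_{2,n}}\phi_I(\Delta)\Big).$$ Moreover, each such point other than $(0,\ldots,0)$ lies in a unique one of the sets $\mathcal{AC}_n$, $\mathcal{HC}_n$, $\phi_I(\mathcal{AC}_m)$, $\phi_I(\mathcal{HC}_m)$ ($3\le m<n$, $I\in\mathcal{I}_{m,n}$), $\phi_I(\Delta)$ ($I\in\mathcal{I}_{2,n}$). Likewise the closure of $\mathcal{C}_n$ in $[0,\infty)^n$ is $$\overline{\mathcal{C}}_n=\mathcal{C}_n\cup\mathcal{BC}_n\cup\Big(\bigcup_{3\leq m<n,\ I\in\mathcal{I}_{m,n}}\phi_I(\mathcal{C}_m\cup\mathcal{BC}_m)\Big)\cup\Big(\bigcup_{I\in\mathcal{I}_{2,n}}\phi_I(\Delta)\Big),$$ and each point of it other than $(0,\ldots,0)$ lies in a unique one of the corresponding sets.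
   Context: For $d\ge0$ and $J\geq d/2$, $J>0$, let $\theta(d,J)=2\sin^{-1}(\sinh(d/2)/\sinh J)\in[0,\pi]$. For $n\ge3$ define $$\mathcal{AC}_n=\Big\{(d_0,\ldots,d_{n-1})\in(0,\infty)^n : \sinh(d_i/2)<\sum_{j\neq i}\sinh(d_j/2)\text{ for each } i\Big\},$$ $$\mathcal{HC}_n=\Big\{(d_0,\ldots,d_{n-1})\in(0,\infty)^n : \sinh(d_{i_0}/2)=\sum_{i\neq i_0}\sinh(d_i/2),\text{ where } d_{i_0}=\max_i d_i\Big\},$$ $$\mathcal{C}_n=\Big\{(d_0,\ldots,d_{n-1})\in(0,\infty)^n : \sum_{i=0}^{n-1}\theta(d_i,D/2)>2\pi,\ D=\max_i d_i\Big\},$$ $$\mathcal{BC}_n=\Big\{(d_0,\ldots,d_{n-1})\in(0,\infty)^n : \sum_{i=0}^{n-1}\theta(d_i,D/2)=2\pi,\ D=\max_i d_i\Big\}.$$ For $0<m<n$ let $\mathcal{I}_{m,n}$ be the collection of $I=(i_0,\ldots,i_{m-1})$ of integers with $0\leq i_0<i_1<\cdots<i_{m-1}\leq n-1$. For such $I$ define $\phi_I\colon\mathbb{R}^m\to\mathbb{R}^n$ by $\phi_I(x_0,\ldots,x_{m-1})=(y_0,\ldots,y_{n-1})$, where $y_i=x_j$ if $i=i_j$ for some $0\leq j\leq m-1$, and $y_i=0$ otherwise. Let $\Delta=\{(r,r) : r\geq0\}$. *)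

theory Defs
  imports "HOL-Analysis.Analysis"
begin

text \<open>
  The space \<open>\<real>\<^sup>n\<close> is the topological space \<^const>\<open>Euclidean_space\<close> \<open>n\<close>: its points are the
  sequences \<open>x :: nat \<Rightarrow> real\<close> with \<open>x i = 0\<close> for all \<open>i \<ge> n\<close>.
\<close>

definition pos_orthant :: "nat \<Rightarrow> (nat \<Rightarrow> real) set" where
  "pos_orthant n = {x \<in> topspace (Euclidean_space n). \<forall>i<n. 0 < x i}"

definition nonneg_orthant :: "nat \<Rightarrow> (nat \<Rightarrow> real) set" where
  "nonneg_orthant n = {x \<in> topspace (Euclidean_space n). \<forall>i<n. 0 \<le> x i}"

text \<open>Only meaningful for \<open>0 \<le> d\<close>, \<open>d / 2 \<le> J\<close> and \<open>0 < J\<close>.\<close>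
definition theta :: "real \<Rightarrow> real \<Rightarrow> real" where
  "theta d J = 2 * arcsin (sinh (d / 2) / sinh J)"

definition max_coord :: "nat \<Rightarrow> (nat \<Rightarrow> real) \<Rightarrow> real" where
  "max_coord n d = Max (d ` {..<n})"

definition AC_set :: "nat \<Rightarrow> (nat \<Rightarrow> real) set" where
  "AC_set n = {d \<in> pos_orthant n.
     \<forall>i<n. sinh (d i / 2) < (\<Sum>j\<in>{..<n} - {i}. sinh (d j / 2))}"

definition HC_set :: "nat \<Rightarrow> (nat \<Rightarrow> real) set" where
  "HC_set n = {d \<in> pos_orthant n.
     \<exists>i0<n. d i0 = max_coord n d \<and>
       sinh (d i0 / 2) = (\<Sum>i\<in>{..<n} - {i0}. sinh (d i / 2))}"

definition C_set :: "nat \<Rightarrow> (nat \<Rightarrow> real) set" where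
  "C_set n = {d \<in> pos_orthant n. (\<Sum>i<n. theta (d i) (max_coord n d / 2)) > 2 * pi}"

definition BC_set :: "nat \<Rightarrow> (nat \<Rightarrow> real) set" where
  "BC_set n = {d \<in> pos_orthant n. (\<Sum>i<n. theta (d i) (max_coord n d / 2)) = 2 * pi}"

definition index_tuples :: "nat \<Rightarrow> nat \<Rightarrow> nat list set" where
  "index_tuples m n = {I. length I = m \<and> sorted_wrt (<) I \<and> set I \<subseteq> {..<n}}"

definition phi :: "nat list \<Rightarrow> (nat \<Rightarrow> real) \<Rightarrow> (nat \<Rightarrow> real)" where
  "phi I x = (\<lambda>i. if i \<in> set I then x (THE j. j < length I \<and> I ! j = i) else 0)"

definition Delta :: "(nat \<Rightarrow> real) set" where
  "Delta = {x \<in> topspace (Euclidean_space 2). \<exists>r\<ge>0. x 0 = r \<and> x 1 = r}"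

text \<open>
  Labels for the pieces of the two decompositions. Uniqueness is expressed for labels, so
  that pieces with different index tuples are distinguished. \<open>A\<close> and \<open>B\<close> below stand for the
  families \<open>AC_set\<close>, \<open>HC_set\<close>, or \<open>C_set\<close>, \<open>BC_set\<close>.
\<close>

datatype piece =
    Whole_A
  | Whole_B
  | Face_A "nat list"
  | Face_B "nat list"
  | Diag "nat list"

definition pieces :: "nat \<Rightarrow> piece set" where
  "pieces n = {Whole_A, Whole_B}
     \<union> (\<Union>m\<in>{3..<n}. Face_A ` index_tuples m n \<union> Face_B ` index_tuples m n)
     \<union> Diag ` index_tuples 2 n"

fun piece_set ::
  "(nat \<Rightarrow> (nat \<Rightarrow> real) set) \<Rightarrow> (nat \<Rightarrow> (nat \<Rightarrow> real) set) \<Rightarrow> nat \<Rightarrow> piece \<Rightarrow> (nat \<Rightarrow> real) set"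
where
  "piece_set A B n Whole_A = A n"
| "piece_set A B n Whole_B = B n"
| "piece_set A B n (Face_A I) = phi I ` A (length I)"
| "piece_set A B n (Face_B I) = phi I ` B (length I)"
| "piece_set A B n (Diag I) = phi I ` Delta"

end

theory Submission
  imports Defs
begin

text \<open>
  For both families, write \<open>s = (\<Sum>i<n. g (sinh (d i / 2) / sinh (D / 2)))\<close> with \<open>D\<close> the largest
  coordinate and \<open>g\<close> continuous and strictly increasing on \<open>[0, 1]\<close>, \<open>g 0 = 0\<close>, \<open>g 1 = 1\<close>. The sets are
  then \<open>s > 2\<close> and \<open>s = 2\<close> in the positive orthant, and the closure is the set of points \<open>x \<ge> 0\<close> with
  \<open>x = 0\<close> or \<open>s \<ge> 2\<close>: the sum is continuous off the origin, and moving all coordinates slightly towards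
  \<open>D\<close> increases it strictly. Since \<open>g 0 = 0\<close>, zero coordinates can be deleted without changing \<open>s\<close>,
  so the piece containing a point is read off from its support and from whether \<open>s > 2\<close> or
  \<open>s = 2\<close>; with two nonzero coordinates \<open>s \<ge> 2\<close> forces them to be equal, and with one \<open>s = 1\<close>.
\<close>

section \<open>Orthants, relative closures and sequences\<close>

lemma mem_pos_orthant:
  "x \<in> pos_orthant n \<longleftrightarrow> (\<forall>i\<ge>n. x i = 0) \<and> (\<forall>i<n. 0 < x i)"
  by (auto simp: pos_orthant_def topspace_Euclidean_space)

lemma mem_nonneg_orthant:
  "x \<in> nonneg_orthant n \<longleftrightarrow> (\<forall>i\<ge>n. x i = 0) \<and> (\<forall>i. 0 \<le> x i)"
  by (auto simp: nonneg_orthant_def topspace_Euclidean_space) (metis linear not_less order_refl)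

lemma pos_orthant_subset_nonneg: "pos_orthant n \<subseteq> nonneg_orthant n"
  by (force simp: pos_orthant_def nonneg_orthant_def)

text \<open>The orthant inherits the same topology from \<open>Euclidean_space n\<close> as from the
  full product \<open>nat => real\<close>. Relative closures can therefore be tested with
  coordinatewise convergent sequences.\<close>

lemma Euclidean_space_closure_of_nonneg_orthant:
  assumes "S \<subseteq> nonneg_orthant n"
  shows "subtopology (Euclidean_space n) (nonneg_orthant n) closure_of S =
    nonneg_orthant n \<inter> closure S"
proof -
  have "nonneg_orthant n \<subseteq> {x. \<forall>i\<ge>n. x i = 0}"
    by (auto simp: mem_nonneg_orthant)
  then have "subtopology (Euclidean_space n) (nonneg_orthant n) =
      subtopology euclidean (nonneg_orthant n)"
    by (simp add: Euclidean_space_def subtopology_subtopology Int_absorb1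
        flip: euclidean_product_topology)
  then show ?thesis
    using assms by (simp add: closure_of_subtopology Int_absorb1)
qed

lemma tendsto_coordinatewise:
  fixes X :: "nat \<Rightarrow> nat \<Rightarrow> real"
  shows "X \<longlonglongrightarrow> x \<longleftrightarrow> (\<forall>i. (\<lambda>k. X k i) \<longlonglongrightarrow> x i)"
  using limitin_componentwise[of "\<lambda>_. euclidean :: real topology" UNIV X x sequentially]
  by (simp add: euclidean_product_topology)

section \<open>The largest coordinate\<close>

lemma max_coord_ge: "i < n \<Longrightarrow> d i \<le> max_coord n d"
  by (simp add: max_coord_def)

lemma max_coord_attained: "0 < n \<Longrightarrow> \<exists>i<n. d i = max_coord n d"
proof -
  assume "0 < n"
  then have "max_coord n d \<in> d ` {..<n}"
    unfolding max_coord_def by (intro Max_in) auto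
  then show ?thesis
    by force
qed

lemma max_coord_eqI:
  "i < n \<Longrightarrow> d i = M \<Longrightarrow> (\<And>j. j < n \<Longrightarrow> d j \<le> M) \<Longrightarrow> max_coord n d = M"
  by (auto simp: max_coord_def intro!: Max_eqI)

lemma max_coord_pos:
  assumes "d \<in> nonneg_orthant n" "d \<noteq> (\<lambda>i. 0)"
  shows "0 < max_coord n d"
proof -
  obtain i where "d i \<noteq> 0"
    using assms(2) by blast
  moreover from this have "i < n"
    using assms(1) not_le by (auto simp: mem_nonneg_orthant)
  moreover have "0 \<le> d i"
    using assms(1) by (simp add: mem_nonneg_orthant)
  ultimately show ?thesis
    using max_coord_ge[of i n d] by linarith
qed

lemma tendsto_max_coord:
  assumes "0 < n" "\<And>i. i < n \<Longrightarrow> (\<lambda>k. X k i) \<longlonglongrightarrow> x i"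
  shows "(\<lambda>k. max_coord n (X k)) \<longlonglongrightarrow> max_coord n x"
  using assms
proof (induction n rule: nat_induct_non_zero)
  case 1
  then show ?case
    by (simp add: max_coord_def lessThan_Suc)
next
  case (Suc n)
  have "max_coord (Suc n) d = max (d n) (max_coord n d)" for d
    using Suc.hyps by (simp add: max_coord_def lessThan_Suc Max_insert lessThan_empty_iff)
  then show ?case
    using Suc.IH Suc.prems by (auto intro!: tendsto_max)
qed

section \<open>Coordinate faces and supports\<close>

text \<open>A strictly increasing tuple has no repeated entry, so the \<open>THE\<close> in
  \<open>phi\<close> has exactly one candidate.\<close>

lemma phi_nth:
  assumes "I \<in> index_tuples m n" "j < m"
  shows "phi I x (I ! j) = x j"
proof -
  have I: "length I = m" "distinct I"
    using assms(1) by (auto simp: index_tuples_def strict_sorted_iff)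
  have "(THE k. k < length I \<and> I ! k = I ! j) = j"
    using I assms(2) by (intro the_equality) (auto simp: nth_eq_iff_index_eq)
  then show ?thesis
    using I assms(2) by (auto simp: phi_def)
qed

lemma phi_outside: "i \<notin> set I \<Longrightarrow> phi I x i = 0"
  by (simp add: phi_def)

lemma index_tuples_nth_bij:
  "I \<in> index_tuples m n \<Longrightarrow> bij_betw ((!) I) {..<m} (set I)"
  by (intro bij_betw_nth) (auto simp: index_tuples_def strict_sorted_iff)

lemma support_phi:
  assumes "I \<in> index_tuples m n" "\<And>j. j < m \<Longrightarrow> y j \<noteq> 0"
  shows "{i. phi I y i \<noteq> 0} = set I"
proof -
  have "phi I y i \<noteq> 0" if i: "i \<in> set I" for i
  proof -
    obtain j where "j < m" "i = I ! j"
      using assms(1) i by (auto simp: index_tuples_def in_set_conv_nth)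
    then show ?thesis
      using phi_nth[OF assms(1)] assms(2) by simp
  qed
  then show ?thesis
    using phi_outside by blast
qed

text \<open>Listing the nonzero coordinates in increasing order compresses a point of the closed
  orthant to a strictly positive point of lower or equal dimension. The empty support is
  included.\<close>

lemma phi_support:
  assumes "x \<in> nonneg_orthant n"
  defines "I \<equiv> sorted_list_of_set {i. x i \<noteq> 0}"
  obtains y where "y \<in> pos_orthant (length I)" "phi I y = x" "I \<in> index_tuples (length I) n"
proof
  let ?y = "\<lambda>j. if j < length I then x (I ! j) else 0"
  have S: "{i. x i \<noteq> 0} \<subseteq> {..<n}"
    using assms(1) not_le by (auto simp: mem_nonneg_orthant)
  then have set_I: "set I = {i. x i \<noteq> 0}"
    using finite_subset[of _ "{..<n}"] by (simp add: I_def)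
  show I: "I \<in> index_tuples (length I) n"
    using S set_I by (auto simp: index_tuples_def I_def)
  have "0 < x i" if "i \<in> set I" for i
    using assms(1) that set_I less_eq_real_def by (auto simp: mem_nonneg_orthant)
  then show "?y \<in> pos_orthant (length I)"
    by (auto simp: mem_pos_orthant)
  show "phi I ?y = x"
  proof
    fix i
    show "phi I ?y i = x i"
    proof (cases "i \<in> set I")
      case True
      then obtain j where "j < length I" "i = I ! j"
        by (metis in_set_conv_nth)
      then show ?thesis
        using phi_nth[OF I] by simp
    next
      case False
      then show ?thesis
        using set_I by (simp add: phi_outside)
    qed
  qed
qed

lemma phi_nonneg:
  assumes I: "I \<in> index_tuples m n" and y: "y \<in> nonneg_orthant m"
  shows "phi I y \<in> nonneg_orthant n"
proof -
  have "0 \<le> phi I y i" for i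
  proof (cases "i \<in> set I")
    case True
    then obtain j where "j < m" "i = I ! j"
      using I by (auto simp: index_tuples_def in_set_conv_nth)
    then show ?thesis
      using phi_nth[OF I] y by (simp add: mem_nonneg_orthant)
  qed (simp add: phi_outside)
  moreover have "phi I y i = 0" if "n \<le> i" for i
    using I that by (intro phi_outside) (auto simp: index_tuples_def)
  ultimately show ?thesis
    by (simp add: mem_nonneg_orthant)
qed

text \<open>The inserted zeros cannot exceed the maximum, since \<open>y\<close> has at least one
  coordinate and none is negative.\<close>

lemma max_coord_phi:
  assumes I: "I \<in> index_tuples m n" and "0 < m" and y: "y \<in> nonneg_orthant m"
  shows "max_coord n (phi I y) = max_coord m y"
proof -
  obtain j where j: "j < m" "y j = max_coord m y"
    using max_coord_attained[OF \<open>0 < m\<close>] by blast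
  show ?thesis
  proof (rule max_coord_eqI)
    show "I ! j < n"
      using I j by (auto simp: index_tuples_def subset_iff)
    show "phi I y (I ! j) = max_coord m y"
      using phi_nth[OF I] j by simp
    fix i
    show "phi I y i \<le> max_coord m y"
    proof (cases "i \<in> set I")
      case True
      then obtain k where "k < m" "i = I ! k"
        using I by (auto simp: index_tuples_def in_set_conv_nth)
      then show ?thesis
        using phi_nth[OF I] max_coord_ge by simp
    next
      case False
      then show ?thesis
        using y j by (simp add: phi_outside mem_nonneg_orthant flip: j(2))
    qed
  qed
qed

lemma mem_Delta:
  "y \<in> Delta \<longleftrightarrow> (\<exists>r\<ge>0. y = (\<lambda>i. if i < 2 then r else 0))"
proof -
  have "y \<in> Delta \<longleftrightarrow> (\<exists>r\<ge>0. \<forall>i. y i = (if i < 2 then r else 0))"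
    unfolding Delta_def topspace_Euclidean_space
    by (fastforce simp: less_2_cases_iff not_less[symmetric])
  then show ?thesis
    by (simp add: fun_eq_iff)
qed

section \<open>Normalized sums and their behaviour on faces and in limits\<close>

text \<open>\<open>AC_set\<close> and \<open>HC_set\<close> correspond to \<open>g t = t\<close>, while \<open>C_set\<close> and \<open>BC_set\<close> correspond to
  \<open>g t = 2 / pi * arcsin t\<close>.\<close>

definition ratio_sum :: "(real \<Rightarrow> real) \<Rightarrow> nat \<Rightarrow> (nat \<Rightarrow> real) \<Rightarrow> real" where
  "ratio_sum g n d = (\<Sum>i<n. g (sinh (d i / 2) / sinh (max_coord n d / 2)))"

text \<open>This places every argument of \<open>g\<close> where \<open>g\<close> is controlled. At
  the origin the ratio is 0 / 0, which evaluates to 0, so the origin is covered as well.\<close>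

lemma ratio_mem:
  assumes "d \<in> nonneg_orthant n" "i < n"
  shows "sinh (d i / 2) / sinh (max_coord n d / 2) \<in> {0..1}"
proof -
  have "0 \<le> d i" "d i \<le> max_coord n d"
    using assms max_coord_ge by (auto simp: mem_nonneg_orthant)
  then show ?thesis
    by (auto simp: divide_le_eq_1)
qed

text \<open>Since the label is a function of the point, uniqueness follows once every piece
  containing the point is shown to carry this label. The inner \<open>else\<close> branches stand
  for the value exactly 2, so the label is meaningful only for nonzero points with
  \<open>2 <= ratio_sum g n x\<close>.\<close>

definition support_piece :: "(real \<Rightarrow> real) \<Rightarrow> nat \<Rightarrow> (nat \<Rightarrow> real) \<Rightarrow> piece" where
  "support_piece g n x =
    (let S = {i. x i \<noteq> 0}; I = sorted_list_of_set S in
     if card S = 2 then Diag I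
     else if card S = n then (if 2 < ratio_sum g n x then Whole_A else Whole_B)
     else (if 2 < ratio_sum g n x then Face_A I else Face_B I))"

text \<open>The values at 0 and 1 are not simplification rules: for \<open>g t = t\<close> they would be instantiated
  to \<open>0 = 0\<close> and \<open>1 = 1\<close>, on which the simplifier loops.\<close>

locale profile =
  fixes g :: "real \<Rightarrow> real"
  assumes strict_mono: "strict_mono_on {0..1} g"
    and continuous: "continuous_on {0..1} g"
    and at_0: "g 0 = 0"
    and at_1: "g 1 = 1"
begin

lemma ratio_sum_phi:
  assumes I: "I \<in> index_tuples m n" and "0 < m" and y: "y \<in> nonneg_orthant m"
  shows "ratio_sum g n (phi I y) = ratio_sum g m y"
proof -
  let ?h = "\<lambda>t. g (sinh (t / 2) / sinh (max_coord m y / 2))"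
  have "ratio_sum g n (phi I y) = (\<Sum>i<n. ?h (phi I y i))"
    using max_coord_phi[OF assms] by (simp add: ratio_sum_def)
  also have "\<dots> = (\<Sum>i\<in>set I. ?h (phi I y i))"
    using I by (intro sum.mono_neutral_right) (auto simp: index_tuples_def phi_outside at_0)
  also have "\<dots> = (\<Sum>j<m. ?h (phi I y (I ! j)))"
    by (rule sum.reindex_bij_betw[symmetric, OF index_tuples_nth_bij[OF I]])
  also have "\<dots> = ratio_sum g m y"
    using phi_nth[OF I] by (simp add: ratio_sum_def)
  finally show ?thesis .
qed

text \<open>All ratios are 1. The value exceeds 2 for \<open>n >= 3\<close>, whatever the size of
  \<open>r\<close>, and is exactly 2 on the diagonal of the plane.\<close>

lemma ratio_sum_const: "0 < r \<Longrightarrow> 0 < n \<Longrightarrow> (\<And>i. i < n \<Longrightarrow> x i = r) \<Longrightarrow> ratio_sum g n x = n"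
proof -
  assume r: "0 < r" "0 < n" "\<And>i. i < n \<Longrightarrow> x i = r"
  have "max_coord n x = r"
    using r by (intro max_coord_eqI[of 0]) auto
  then show ?thesis
    using r by (simp add: ratio_sum_def at_1)
qed

text \<open>The limit is nonzero, so its largest coordinate is positive and the quotients converge.
  As \<open>g\<close> is continuous only on \<open>{0..1}\<close>, all ratios must be kept inside
  that interval.\<close>

lemma tendsto_ratio_sum:
  assumes X: "\<And>k. X k \<in> nonneg_orthant n" "X \<longlonglongrightarrow> x"
    and x: "x \<in> nonneg_orthant n" "x \<noteq> (\<lambda>i. 0)"
  shows "(\<lambda>k. ratio_sum g n (X k)) \<longlonglongrightarrow> ratio_sum g n x"
  unfolding ratio_sum_def
proof (intro tendsto_sum)
  fix i assume "i \<in> {..<n}"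
  then have i: "i < n" and "0 < n"
    by auto
  have lim: "(\<lambda>k. X k j) \<longlonglongrightarrow> x j" for j
    using X(2) by (simp add: tendsto_coordinatewise)
  have "(\<lambda>k. sinh (X k i / 2) / sinh (max_coord n (X k) / 2)) \<longlonglongrightarrow>
      sinh (x i / 2) / sinh (max_coord n x / 2)"
    using max_coord_pos[OF x] tendsto_max_coord[OF \<open>0 < n\<close> lim]
    by (intro tendsto_divide tendsto_sinh lim) auto
  then show "(\<lambda>k. g (sinh (X k i / 2) / sinh (max_coord n (X k) / 2))) \<longlonglongrightarrow>
      g (sinh (x i / 2) / sinh (max_coord n x / 2))"
    using continuous ratio_mem[OF X(1) i] ratio_mem[OF x(1) i]
    by (intro continuous_on_tendsto_compose[of "{0..1}" g]) auto
qed

section \<open>Closure of the superlevel set\<close>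

lemma approximation:
  assumes "3 \<le> n" and x: "x \<in> nonneg_orthant n" "x \<noteq> (\<lambda>i. 0)" "2 \<le> ratio_sum g n x"
  shows "x \<in> closure {d \<in> pos_orthant n. 2 < ratio_sum g n d}"
proof -
  define D where "D = max_coord n x"
  have D: "0 < D" "\<And>i. i < n \<Longrightarrow> x i \<le> D"
    using max_coord_pos[OF x(1,2)] max_coord_ge by (auto simp: D_def)
  obtain m where m: "m < n" "x m = D"
    using max_coord_attained[of n x] assms(1) by (auto simp: D_def)
  \<comment> \<open>Convex combination with the point all of whose coordinates are \<open>D\<close>:
    the maximum stays \<open>D\<close>, and every zero coordinate becomes positive.\<close>
  define X where
    "X k i = (if i < n then x i + inverse (real (Suc k)) * (D - x i) else 0)" for k i
  have "X k \<in> {d \<in> pos_orthant n. 2 < ratio_sum g n d}" for k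
  proof -
    define t where "t = inverse (real (Suc k))"
    have t: "0 < t" "t \<le> 1"
      by (auto simp: t_def field_simps)
    have X: "X k i = (1 - t) * x i + t * D" if "i < n" for i
      using that by (simp add: X_def t_def algebra_simps)
    have x_nonneg: "0 \<le> x i" for i
      using x(1) by (simp add: mem_nonneg_orthant)
    have pos: "X k \<in> pos_orthant n"
      using X t D(1) x_nonneg by (auto simp: mem_pos_orthant X_def[of k] intro!: add_nonneg_pos)
    have le: "X k i \<le> D" if "i < n" for i
      using mult_left_mono[OF D(2)[OF that], of "1 - t"] t X[OF that] by (simp add: algebra_simps)
    have ge: "x i \<le> X k i" if "i < n" for i
      using D(2)[OF that] t that by (simp add: X_def t_def)
    have max: "max_coord n (X k) = D"
      using m le by (intro max_coord_eqI[of m]) (auto simp: X_def)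
    have mem: "sinh (x i / 2) / sinh (D / 2) \<in> {0..1}"
      "sinh (X k i / 2) / sinh (D / 2) \<in> {0..1}" if "i < n" for i
      using ratio_mem[OF x(1) that] ratio_mem[OF subsetD[OF pos_orthant_subset_nonneg pos] that] max
      by (auto simp: D_def)
    have "2 < ratio_sum g n (X k)"
    \<comment> \<open>If all coordinates equal \<open>D\<close>, the perturbation changes nothing,
      but the sum is already \<open>n >= 3\<close>. Otherwise the denominators agree and the sums
      compare termwise, strictly at a coordinate below \<open>D\<close>.\<close>
    proof (cases "\<forall>i<n. x i = D")
      case True
      then have "X k i = D" if "i < n" for i
        using that X by (simp add: algebra_simps)
      then show ?thesis
        using ratio_sum_const[of D n "X k"] D(1) assms(1) by simp
    next
      case False
      then obtain j where j: "j < n" "x j < D"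
        using D(2) less_eq_real_def by blast
      have "ratio_sum g n x < ratio_sum g n (X k)"
        unfolding ratio_sum_def max D_def[symmetric]
      proof (rule sum_strict_mono_ex1)
        have "x j < X k j"
          using j t by (simp add: X_def t_def)
        then show "\<exists>i\<in>{..<n}. g (sinh (x i / 2) / sinh (D / 2)) < g (sinh (X k i / 2) / sinh (D / 2))"
          using j D(1) mem[OF j(1)]
          by (intro bexI[of _ j] strict_mono_onD[OF strict_mono] divide_strict_right_mono) auto
        show "\<forall>i\<in>{..<n}. g (sinh (x i / 2) / sinh (D / 2)) \<le> g (sinh (X k i / 2) / sinh (D / 2))"
          using D(1) mem ge
          by (intro ballI strict_mono_on_leD[OF strict_mono] divide_right_mono) auto
      qed simp
      then show ?thesis
        using x(3) by linarith
    qed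
    then show ?thesis
      using pos by simp
  qed
  moreover have "X \<longlonglongrightarrow> x"
    unfolding tendsto_coordinatewise
  proof
    fix i
    show "(\<lambda>k. X k i) \<longlonglongrightarrow> x i"
    proof (cases "i < n")
      case True
      have "(\<lambda>k. x i + inverse (real (Suc k)) * (D - x i)) \<longlonglongrightarrow> x i + 0 * (D - x i)"
        by (intro tendsto_intros LIMSEQ_inverse_real_of_nat)
      then show ?thesis
        using True by (simp add: X_def)
    next
      case False
      then show ?thesis
        using x(1) by (simp add: X_def mem_nonneg_orthant)
    qed
  qed
  ultimately show ?thesis
    unfolding closure_sequential by blast
qed

text \<open>The sum has value 0 at the origin and is not continuous there, so small points with
  equal coordinates are used instead.\<close>

lemma zero_approximation:
  assumes "3 \<le> n"
  shows "(\<lambda>i. 0) \<in> closure {d \<in> pos_orthant n. 2 < ratio_sum g n d}"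
proof -
  define X where "X k i = (if i < n then inverse (real (Suc k)) else 0)" for k i
  have "X k \<in> {d \<in> pos_orthant n. 2 < ratio_sum g n d}" for k
    using assms ratio_sum_const[of "inverse (real (Suc k))" n "X k"]
    by (auto simp: mem_pos_orthant X_def)
  moreover have "X \<longlonglongrightarrow> (\<lambda>i. 0)"
    unfolding tendsto_coordinatewise
  proof
    show "(\<lambda>k. X k i) \<longlonglongrightarrow> 0" for i
      using LIMSEQ_inverse_real_of_nat by (cases "i < n") (simp_all add: X_def)
  qed
  ultimately show ?thesis
    unfolding closure_sequential by blast
qed

text \<open>In the limit \<open>2 <\<close> weakens to \<open>2 <=\<close>; the two approximation
  lemmas give the converse.\<close>

lemma closure_ratio_sum:
  assumes "3 \<le> n"
  shows "nonneg_orthant n \<inter> closure {d \<in> pos_orthant n. 2 < ratio_sum g n d} =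
    {x \<in> nonneg_orthant n. x = (\<lambda>i. 0) \<or> 2 \<le> ratio_sum g n x}"
proof -
  have "2 \<le> ratio_sum g n x"
    if x: "x \<in> nonneg_orthant n" "x \<noteq> (\<lambda>i. 0)"
      and cl: "x \<in> closure {d \<in> pos_orthant n. 2 < ratio_sum g n d}" for x
  proof -
    obtain X where X: "\<And>k. X k \<in> pos_orthant n" "\<And>k. 2 < ratio_sum g n (X k)" "X \<longlonglongrightarrow> x"
      using cl unfolding closure_sequential by blast
    have "(\<lambda>k. ratio_sum g n (X k)) \<longlonglongrightarrow> ratio_sum g n x"
      using X pos_orthant_subset_nonneg x by (intro tendsto_ratio_sum) auto
    then show ?thesis
      using X(2) by (intro LIMSEQ_le_const) (auto intro: less_imp_le)
  qed
  then show ?thesis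
    using approximation[OF assms] zero_approximation[OF assms] by blast
qed

text \<open>Each term is at most 1, so the sum is at most \<open>m\<close>. For \<open>m = 2\<close>
  both terms must equal 1, and injectivity of \<open>g\<close> and of \<open>sinh\<close> makes both
  coordinates equal to the maximum.\<close>

lemma ratio_sum_ge_2_dim:
  assumes y: "y \<in> pos_orthant m" and "2 \<le> ratio_sum g m y"
  shows "2 \<le> m" and "m = 2 \<Longrightarrow> y \<in> Delta"
proof -
  have nn: "y \<in> nonneg_orthant m"
    using y pos_orthant_subset_nonneg by blast
  have le1: "g t \<le> 1" if "t \<in> {0..1}" for t
    using strict_mono_on_leD[OF strict_mono that, of 1] that by (simp add: at_1)
  have "ratio_sum g m y \<le> (\<Sum>i<m. 1)"
    unfolding ratio_sum_def using ratio_mem[OF nn] le1 by (intro sum_mono) blast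
  then show "2 \<le> m"
    using assms(2) by simp
  assume m: "m = 2"
  define D where "D = max_coord m y"
  let ?r = "\<lambda>i. sinh (y i / 2) / sinh (D / 2)"
  have r: "?r i \<in> {0..1}" if "i < 2" for i
    using ratio_mem[OF nn] that m by (simp add: D_def)
  have "2 \<le> g (?r 0) + g (?r 1)"
    using assms(2) by (simp add: ratio_sum_def m D_def numeral_2_eq_2)
  then have eq1: "g (?r i) = 1" if "i < 2" for i
    using le1[OF r[of 0]] le1[OF r[of 1]] that by (auto simp: less_2_cases_iff)
  have "y i = D" if "i < 2" for i
  proof -
    have "?r i = 1"
      using eq1[OF that] r[OF that]
        inj_on_eq_iff[OF strict_mono_on_imp_inj_on[OF strict_mono], of "?r i" 1] by (simp add: at_1)
    then show ?thesis
      by simp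
  qed
  then have "y = (\<lambda>i. if i < 2 then D else 0)" "0 \<le> D"
    using y m by (force simp: mem_pos_orthant)+
  then show "y \<in> Delta"
    unfolding mem_Delta by blast
qed

end

section \<open>Decomposition of the closure into labelled pieces\<close>

locale profile_family = profile +
  fixes A B :: "nat \<Rightarrow> (nat \<Rightarrow> real) set"
  assumes A: "3 \<le> m \<Longrightarrow> A m = {d \<in> pos_orthant m. 2 < ratio_sum g m d}"
    and B: "3 \<le> m \<Longrightarrow> B m = {d \<in> pos_orthant m. ratio_sum g m d = 2}"
begin

text \<open>\<open>piece_set\<close> reads the dimension of a face off its tuple; this agrees with
  \<open>m\<close> because tuples in \<open>index_tuples m n\<close> have length
  \<open>m\<close>.\<close>

lemma Union_pieces:
  "(\<Union>p\<in>pieces n. piece_set A B n p) =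
    A n \<union> B n \<union> (\<Union>m\<in>{3..<n}. \<Union>I\<in>index_tuples m n. phi I ` (A m \<union> B m))
      \<union> (\<Union>I\<in>index_tuples 2 n. phi I ` Delta)"
proof -
  have "length I = m" if "I \<in> index_tuples m n" for I m
    using that by (simp add: index_tuples_def)
  then show ?thesis
    unfolding pieces_def by (simp add: UN_Un image_Un Un_assoc cong: SUP_cong) (blast)
qed

text \<open>Soundness of the labels: it yields both the inclusion of the pieces in the closure and
  the uniqueness of the label.\<close>

lemma mem_piece:
  assumes n: "3 \<le> n" and p: "p \<in> pieces n" "x \<in> piece_set A B n p"
  shows "x \<in> nonneg_orthant n"
    and "x \<noteq> (\<lambda>i. 0) \<Longrightarrow> 2 \<le> ratio_sum g n x \<and> p = support_piece g n x"
proof -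
  have whole: "{i. x i \<noteq> 0} = {..<n}" if "x \<in> pos_orthant n"
    using that by (fastforce simp: mem_pos_orthant simp flip: not_less)
  \<comment> \<open>A positive \<open>y\<close> makes the support of \<open>phi I y\<close> exactly
    \<open>set I\<close>, and sorting this set recovers \<open>I\<close>.\<close>
  have face: "x \<in> nonneg_orthant n \<and> card {i. x i \<noteq> 0} = m \<and>
      sorted_list_of_set {i. x i \<noteq> 0} = I \<and> ratio_sum g n x = ratio_sum g m y"
    if "I \<in> index_tuples m n" "0 < m" "y \<in> pos_orthant m" "x = phi I y" for I m y
  proof -
    have "{i. x i \<noteq> 0} = set I"
      unfolding that(4) using that(3) by (intro support_phi[OF that(1)]) (force simp: mem_pos_orthant)
    moreover have "sorted I" "distinct I" "length I = m"
      using that(1) by (auto simp: index_tuples_def strict_sorted_iff)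
    moreover have "y \<in> nonneg_orthant m"
      using that(3) pos_orthant_subset_nonneg by blast
    ultimately show ?thesis
      using phi_nonneg[OF that(1)] ratio_sum_phi[OF that(1,2)]
      by (simp add: that(4) distinct_card sorted_list_of_set.idem_if_sorted_distinct)
  qed
  consider (whole_A) "p = Whole_A" "x \<in> A n" | (whole_B) "p = Whole_B" "x \<in> B n"
    | (face_A) m I y where "p = Face_A I" "m \<in> {3..<n}" "I \<in> index_tuples m n" "y \<in> A m" "x = phi I y"
    | (face_B) m I y where "p = Face_B I" "m \<in> {3..<n}" "I \<in> index_tuples m n" "y \<in> B m" "x = phi I y"
    | (diag) I r where "p = Diag I" "I \<in> index_tuples 2 n" "0 \<le> r"
        "x = phi I (\<lambda>i. if i < 2 then r else 0)"
    using p by (auto simp: pieces_def index_tuples_def mem_Delta)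
  then have "x \<in> nonneg_orthant n \<and>
      (x \<noteq> (\<lambda>i. 0) \<longrightarrow> 2 \<le> ratio_sum g n x \<and> p = support_piece g n x)"
  proof cases
    case whole_A
    then show ?thesis
      using n whole pos_orthant_subset_nonneg by (auto simp: A support_piece_def)
  next
    case whole_B
    then show ?thesis
      using n whole pos_orthant_subset_nonneg by (auto simp: B support_piece_def)
  next
    case face_A
    then show ?thesis
      using n face[of I m y] by (auto simp: A support_piece_def Let_def)
  next
    case face_B
    then show ?thesis
      using n face[of I m y] by (auto simp: B support_piece_def Let_def)
  next
    case diag
    let ?y = "\<lambda>i::nat. if i < 2 then r else 0"
    have "?y \<in> nonneg_orthant 2"
      using diag by (simp add: mem_nonneg_orthant)
    then have "x \<in> nonneg_orthant n"
      using phi_nonneg diag by blast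
    moreover have "2 \<le> ratio_sum g n x \<and> p = support_piece g n x" if "x \<noteq> (\<lambda>i. 0)"
    proof -
      \<comment> \<open>Away from the origin a diagonal point comes from a positive point of
        dimension 2, so \<open>face\<close> applies to it too.\<close>
      have "r \<noteq> 0"
        using that diag by (auto simp: phi_def)
      then have "?y \<in> pos_orthant 2" "ratio_sum g 2 ?y = 2"
        using diag ratio_sum_const[of r 2 ?y] by (auto simp: mem_pos_orthant)
      then show ?thesis
        using face[of I 2 ?y] diag by (simp add: support_piece_def Let_def)
    qed
    ultimately show ?thesis
      by blast
  qed
  then show "x \<in> nonneg_orthant n"
    "x \<noteq> (\<lambda>i. 0) \<Longrightarrow> 2 \<le> ratio_sum g n x \<and> p = support_piece g n x"
    by auto
qed

text \<open>Completeness of the labels: the point is compressed to a positive \<open>y\<close> of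
  dimension \<open>m\<close> with the same sum. The bound on the sum gives \<open>2 <= m\<close>,
  and the three possible ranges of \<open>m\<close> match the kinds of pieces.\<close>

lemma support_piece_mem:
  assumes n: "3 \<le> n" and x: "x \<in> nonneg_orthant n" "x \<noteq> (\<lambda>i. 0)" "2 \<le> ratio_sum g n x"
  shows "support_piece g n x \<in> pieces n" and "x \<in> piece_set A B n (support_piece g n x)"
proof -
  define I where "I = sorted_list_of_set {i. x i \<noteq> 0}"
  define m where "m = length I"
  obtain y where y: "y \<in> pos_orthant m" "phi I y = x" and I: "I \<in> index_tuples m n"
    using phi_support[OF x(1)] by (auto simp: I_def m_def)
  have nn: "y \<in> nonneg_orthant m"
    using y pos_orthant_subset_nonneg by blast
  have "m \<noteq> 0"
    using x(2) y I by (auto simp: phi_def index_tuples_def)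
  then have rs: "ratio_sum g n x = ratio_sum g m y"
    using ratio_sum_phi[OF I _ nn] y by simp
  have dim: "2 \<le> m" "m = 2 \<Longrightarrow> y \<in> Delta"
    using ratio_sum_ge_2_dim[OF y(1)] rs x(3) by auto
  have card: "card {i. x i \<noteq> 0} = m"
    by (simp add: m_def I_def)
  have S: "{i. x i \<noteq> 0} \<subseteq> {..<n}"
    using x(1) not_le by (auto simp: mem_nonneg_orthant)
  then have "m \<le> n"
    using card card_mono[OF _ S] by simp
  have whole: "x \<in> pos_orthant n" if "m = n"
  proof -
    have "{i. x i \<noteq> 0} = {..<n}"
      using S card that by (intro card_subset_eq) auto
    then show ?thesis
      using x(1) by (auto simp: mem_pos_orthant mem_nonneg_orthant less_eq_real_def)
  qed
  have "support_piece g n x \<in> pieces n \<and> x \<in> piece_set A B n (support_piece g n x)"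
  proof -
    consider "m = 2" | "m = n" "m \<noteq> 2" | "3 \<le> m" "m < n"
      using dim(1) \<open>m \<le> n\<close> by linarith
    then show ?thesis
    proof cases
      case 1
      then show ?thesis
        using card dim(2) I y by (auto simp: support_piece_def I_def[symmetric] pieces_def)
    next
      case 2
      then show ?thesis
        using card whole x(3) n by (auto simp: support_piece_def I_def[symmetric] pieces_def A B)
    next
      case 3
      then show ?thesis
        using card I y rs x(3)
        by (auto simp: support_piece_def I_def[symmetric] pieces_def A B m_def[symmetric])
    qed
  qed
  then show "support_piece g n x \<in> pieces n" "x \<in> piece_set A B n (support_piece g n x)"
    by auto
qed

text \<open>The origin lies in every diagonal piece, hence its exclusion from uniqueness; the tuple
  \<open>[0, 1]\<close> is one choice.\<close>

lemma zero_mem_piece: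
  assumes "3 \<le> n"
  shows "\<exists>p\<in>pieces n. (\<lambda>i. 0) \<in> piece_set A B n p"
proof
  have "phi [0, 1] (\<lambda>i. 0) = (\<lambda>i. 0)"
    by (auto simp: phi_def)
  moreover have "(\<lambda>i. 0) \<in> Delta"
    by (auto simp: mem_Delta)
  ultimately show "(\<lambda>i. 0) \<in> piece_set A B n (Diag [0, 1])"
    by (metis image_eqI piece_set.simps(5))
  show "Diag [0, 1] \<in> pieces n"
    using assms by (auto simp: pieces_def index_tuples_def)
qed

lemma closure_of_A:
  assumes "3 \<le> n"
  shows "subtopology (Euclidean_space n) (nonneg_orthant n) closure_of A n =
    {x \<in> nonneg_orthant n. x = (\<lambda>i. 0) \<or> 2 \<le> ratio_sum g n x}"
proof -
  have "A n \<subseteq> nonneg_orthant n"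
    using A[OF assms] pos_orthant_subset_nonneg by auto
  then show ?thesis
    using closure_ratio_sum[OF assms]
    by (simp add: Euclidean_space_closure_of_nonneg_orthant A[OF assms])
qed

theorem closure_decomposition:
  assumes "3 \<le> n"
  shows "subtopology (Euclidean_space n) (nonneg_orthant n) closure_of A n =
    A n \<union> B n \<union> (\<Union>m\<in>{3..<n}. \<Union>I\<in>index_tuples m n. phi I ` (A m \<union> B m))
      \<union> (\<Union>I\<in>index_tuples 2 n. phi I ` Delta)"
  unfolding closure_of_A[OF assms] Union_pieces[symmetric]
proof (intro equalityI subsetI)
  fix x assume "x \<in> {x \<in> nonneg_orthant n. x = (\<lambda>i. 0) \<or> 2 \<le> ratio_sum g n x}"
  then show "x \<in> (\<Union>p\<in>pieces n. piece_set A B n p)"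
    using support_piece_mem[OF assms] zero_mem_piece[OF assms] by (cases "x = (\<lambda>i. 0)") auto
next
  fix x assume "x \<in> (\<Union>p\<in>pieces n. piece_set A B n p)"
  then show "x \<in> {x \<in> nonneg_orthant n. x = (\<lambda>i. 0) \<or> 2 \<le> ratio_sum g n x}"
    using mem_piece[OF assms] by auto
qed

theorem unique_piece:
  assumes "3 \<le> n"
    and "x \<in> subtopology (Euclidean_space n) (nonneg_orthant n) closure_of A n" "x \<noteq> (\<lambda>i. 0)"
  shows "\<exists>!p. p \<in> pieces n \<and> x \<in> piece_set A B n p"
proof (rule ex1I[of _ "support_piece g n x"])
  have "x \<in> nonneg_orthant n" "2 \<le> ratio_sum g n x"
    using assms(2,3) by (simp_all add: closure_of_A[OF assms(1)])
  then show "support_piece g n x \<in> pieces n \<and> x \<in> piece_set A B n (support_piece g n x)"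
    using support_piece_mem[OF assms(1) _ assms(3)] by blast
  show "p = support_piece g n x" if "p \<in> pieces n \<and> x \<in> piece_set A B n p" for p
    using mem_piece(2)[OF assms(1) _ _ assms(3)] that by blast
qed

end

section \<open>The two concrete families\<close>

text \<open>Moving the omitted term across turns the defining conditions into comparisons of
  \<open>2 * sinh (d i / 2)\<close> with one fixed total.\<close>

lemma sum_sinh_others:
  fixes d :: "nat \<Rightarrow> real"
  assumes "i < n"
  shows "(\<Sum>j\<in>{..<n} - {i}. sinh (d j / 2)) = (\<Sum>j<n. sinh (d j / 2)) - sinh (d i / 2)"
  using assms by (simp add: sum_diff1)

lemma ratio_sum_id:
  "ratio_sum (\<lambda>t. t) n d = (\<Sum>i<n. sinh (d i / 2)) / sinh (max_coord n d / 2)"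
  by (simp add: ratio_sum_def sum_divide_distrib)

lemma pos_orthant_max_coord_pos:
  "d \<in> pos_orthant n \<Longrightarrow> 0 < n \<Longrightarrow> 0 < max_coord n d"
  using max_coord_ge[of 0 n d] by (force simp: mem_pos_orthant)

text \<open>As \<open>sinh\<close> is increasing, the inequalities for all indices reduce to the one
  at a maximal coordinate; dividing by its \<open>sinh\<close> gives the threshold 2.\<close>

lemma AC_set_ratio_sum:
  assumes "0 < n"
  shows "AC_set n = {d \<in> pos_orthant n. 2 < ratio_sum (\<lambda>t. t) n d}"
proof -
  have "(\<forall>i<n. sinh (d i / 2) < (\<Sum>j\<in>{..<n} - {i}. sinh (d j / 2))) \<longleftrightarrow>
      2 < ratio_sum (\<lambda>t. t) n d" if d: "d \<in> pos_orthant n" for d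
  proof -
    let ?u = "\<lambda>i. sinh (d i / 2)" and ?M = "sinh (max_coord n d / 2)"
    have "0 < ?M"
      using pos_orthant_max_coord_pos[OF d assms] by simp
    then have "2 < ratio_sum (\<lambda>t. t) n d \<longleftrightarrow> 2 * ?M < (\<Sum>i<n. ?u i)"
      by (simp add: ratio_sum_id less_divide_eq)
    also have "\<dots> \<longleftrightarrow> (\<forall>i<n. 2 * ?u i < (\<Sum>i<n. ?u i))"
    proof
      have le: "?u i \<le> ?M" if "i < n" for i
        using max_coord_ge[OF that, of d] by simp
      show "\<forall>i<n. 2 * ?u i < (\<Sum>i<n. ?u i)" if "2 * ?M < (\<Sum>i<n. ?u i)"
        using that le by (meson le_less_trans mult_left_mono zero_le_numeral)
      show "2 * ?M < (\<Sum>i<n. ?u i)" if "\<forall>i<n. 2 * ?u i < (\<Sum>i<n. ?u i)"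
        using that max_coord_attained[OF assms, of d] by metis
    qed
    finally show ?thesis
      by (auto simp: sum_sinh_others)
  qed
  then show ?thesis
    unfolding AC_set_def by blast
qed

text \<open>Every index attaining the maximum yields the same equation, so the choice of
  \<open>i0\<close> is immaterial.\<close>

lemma HC_set_ratio_sum:
  assumes "0 < n"
  shows "HC_set n = {d \<in> pos_orthant n. ratio_sum (\<lambda>t. t) n d = 2}"
proof -
  have "(\<exists>i<n. d i = max_coord n d \<and> sinh (d i / 2) = (\<Sum>j\<in>{..<n} - {i}. sinh (d j / 2))) \<longleftrightarrow>
      ratio_sum (\<lambda>t. t) n d = 2" if d: "d \<in> pos_orthant n" for d
  proof -
    let ?u = "\<lambda>i. sinh (d i / 2)" and ?M = "sinh (max_coord n d / 2)"
    have "0 < ?M"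
      using pos_orthant_max_coord_pos[OF d assms] by simp
    then have "ratio_sum (\<lambda>t. t) n d = 2 \<longleftrightarrow> 2 * ?M = (\<Sum>i<n. ?u i)"
      by (auto simp: ratio_sum_id divide_eq_eq)
    also have "\<dots> \<longleftrightarrow> (\<exists>i<n. d i = max_coord n d \<and> 2 * ?u i = (\<Sum>i<n. ?u i))"
      using max_coord_attained[OF assms, of d] by metis
    finally show ?thesis
      by (auto simp: sum_sinh_others)
  qed
  then show ?thesis
    unfolding HC_set_def by blast
qed

text \<open>The factor \<open>2 / pi\<close> normalizes \<open>arcsin 1 = pi / 2\<close> to 1, so
  the angle sum \<open>2 * pi\<close> corresponds to the threshold 2.\<close>

lemma sum_theta:
  "(\<Sum>i<n. theta (d i) (max_coord n d / 2)) = pi * ratio_sum (\<lambda>t. 2 / pi * arcsin t) n d"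
  by (simp add: ratio_sum_def theta_def sum_distrib_left)

lemma C_set_ratio_sum:
  "C_set n = {d \<in> pos_orthant n. 2 < ratio_sum (\<lambda>t. 2 / pi * arcsin t) n d}"
  unfolding C_set_def sum_theta by (simp add: mult.commute[of 2 pi])

lemma BC_set_ratio_sum:
  "BC_set n = {d \<in> pos_orthant n. ratio_sum (\<lambda>t. 2 / pi * arcsin t) n d = 2}"
  unfolding BC_set_def sum_theta by (simp add: mult.commute[of 2 pi])

interpretation AC: profile_family "\<lambda>t. t" AC_set HC_set
proof
  show "strict_mono_on {0..1} (\<lambda>t::real. t)"
    by (simp add: strict_mono_on_def)
  show "AC_set m = {d \<in> pos_orthant m. 2 < ratio_sum (\<lambda>t. t) m d}" if "3 \<le> m" for m
    using that by (intro AC_set_ratio_sum) simp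
  show "HC_set m = {d \<in> pos_orthant m. ratio_sum (\<lambda>t. t) m d = 2}" if "3 \<le> m" for m
    using that by (intro HC_set_ratio_sum) simp
qed simp_all

lemma strict_mono_scaled_arcsin: "strict_mono_on {0..1::real} (\<lambda>t. 2 / pi * arcsin t)"
proof (rule strict_mono_onI)
  fix s t :: real assume "s \<in> {0..1}" "t \<in> {0..1}" "s < t"
  then have "arcsin s < arcsin t"
    by (intro arcsin_less_arcsin) auto
  then show "2 / pi * arcsin s < 2 / pi * arcsin t"
    by (rule mult_strict_left_mono) simp
qed

lemma continuous_on_scaled_arcsin: "continuous_on {0..1::real} (\<lambda>t. 2 / pi * arcsin t)"
proof -
  have "continuous_on {0..1::real} arcsin"
    by (rule continuous_on_subset[OF continuous_on_arcsin']) simp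
  then show ?thesis
    by (rule continuous_on_mult_left)
qed

interpretation C: profile_family "\<lambda>t. 2 / pi * arcsin t" C_set BC_set
  by (rule profile_family.intro[OF profile.intro profile_family_axioms.intro])
    (simp_all only: strict_mono_scaled_arcsin continuous_on_scaled_arcsin
      C_set_ratio_sum BC_set_ratio_sum, simp_all)

theorem lemma5p1:
  fixes n :: nat
  assumes "3 \<le> n"
  shows
    "subtopology (Euclidean_space n) (nonneg_orthant n) closure_of AC_set n =
       AC_set n \<union> HC_set n
       \<union> (\<Union>m\<in>{3..<n}. \<Union>I\<in>index_tuples m n. phi I ` (AC_set m \<union> HC_set m))
       \<union> (\<Union>I\<in>index_tuples 2 n. phi I ` Delta)
     \<and> (\<forall>x \<in> subtopology (Euclidean_space n) (nonneg_orthant n) closure_of AC_set n.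
          x \<noteq> (\<lambda>i. 0) \<longrightarrow> (\<exists>!p. p \<in> pieces n \<and> x \<in> piece_set AC_set HC_set n p))
     \<and> subtopology (Euclidean_space n) (nonneg_orthant n) closure_of C_set n =
       C_set n \<union> BC_set n
       \<union> (\<Union>m\<in>{3..<n}. \<Union>I\<in>index_tuples m n. phi I ` (C_set m \<union> BC_set m))
       \<union> (\<Union>I\<in>index_tuples 2 n. phi I ` Delta)
     \<and> (\<forall>x \<in> subtopology (Euclidean_space n) (nonneg_orthant n) closure_of C_set n.
          x \<noteq> (\<lambda>i. 0) \<longrightarrow> (\<exists>!p. p \<in> pieces n \<and> x \<in> piece_set C_set BC_set n p))"
  by (intro conjI ballI impI AC.closure_decomposition[OF assms] AC.unique_piece[OF assms]
      C.closure_decomposition[OF assms] C.unique_piece[OF assms])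

end
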